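(* Let $\mathbb{F}$ be a field of characteristic $p=2$ and let $K=\mathbb{F}(t_1,t_2,\ldots)$ be the field of rational functions over $\mathbb{F}$ in infinitely many indeterminates $t_1,t_2,\ldots$. Then there exists an infinite-dimensional abelian restricted Lie algebra $L$ over $K$ such that the restricted enveloping algebra $u(L)$ is semiperfect and $\mathcal{O}_p(L)=0$.
   Context: For a ring $R$ with unity, $\mathcal{J}(R)$ denotes its Jacobson radical. $R$ is semiperfect if $R/\mathcal{J}(R)$ is Artinian and idempotents of $R/\mathcal{J}(R)$ can be lifted to $R$. For a restricted Lie algebra $L$ over a field of characteristic $p>0$ with $p$-map $x\mapsto x^{[p]}$, $u(L)$ denotes its restricted enveloping algebra. An element $x\in L$ is $p$-nilpotent if $x^{[p]^n}=0$ for some $n\geq 1$, where $x^{[p]^n}$ is the $n$-fold iterate of the $p$-map applied to $x$. A subset of $L$ is $p$-nil if each of its elements is $p$-nilpotent. A restricted ideal is a Lie ideal closed under the $p$-map. $\mathcal{O}_p(L)$ denotes the sum of all $p$-nil restricted ideals of $L$; it is itself a $p$-nil restricted ideal. *)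

theory Defs
  imports
    "HOL-Algebra.QuotRing"
    "HOL-Algebra.Algebraic_Closure_Type"
    "HOL-Library.Poly_Mapping"
begin

section \<open>Rings: Jacobson radical, Artinian and semiperfect rings\<close>

definition left_ideal :: "'a set \<Rightarrow> ('a, 'b) ring_scheme \<Rightarrow> bool" where
  "left_ideal I R \<longleftrightarrow> additive_subgroup I R \<and> (\<forall>r\<in>carrier R. \<forall>x\<in>I. r \<otimes>\<^bsub>R\<^esub> x \<in> I)"

definition right_ideal :: "'a set \<Rightarrow> ('a, 'b) ring_scheme \<Rightarrow> bool" where
  "right_ideal I R \<longleftrightarrow> additive_subgroup I R \<and> (\<forall>r\<in>carrier R. \<forall>x\<in>I. x \<otimes>\<^bsub>R\<^esub> r \<in> I)"

definition maximal_left_ideal :: "'a set \<Rightarrow> ('a, 'b) ring_scheme \<Rightarrow> bool" where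
  "maximal_left_ideal M R \<longleftrightarrow> left_ideal M R \<and> M \<noteq> carrier R \<and>
     (\<forall>I. left_ideal I R \<longrightarrow> M \<subseteq> I \<longrightarrow> I = M \<or> I = carrier R)"

definition jacobson_radical :: "('a, 'b) ring_scheme \<Rightarrow> 'a set" where
  "jacobson_radical R = carrier R \<inter> \<Inter>{M. maximal_left_ideal M R}"

text \<open>Artinian means left and right Artinian, as descending chain conditions.\<close>

definition artinian_ring :: "('a, 'b) ring_scheme \<Rightarrow> bool" where
  "artinian_ring R \<longleftrightarrow> ring R \<and>
     (\<forall>I :: nat \<Rightarrow> 'a set. (\<forall>n. left_ideal (I n) R \<and> I (Suc n) \<subseteq> I n)
        \<longrightarrow> (\<exists>m. \<forall>n\<ge>m. I n = I m)) \<and>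
     (\<forall>I :: nat \<Rightarrow> 'a set. (\<forall>n. right_ideal (I n) R \<and> I (Suc n) \<subseteq> I n)
        \<longrightarrow> (\<exists>m. \<forall>n\<ge>m. I n = I m))"

definition idempotent_in :: "'a \<Rightarrow> ('a, 'b) ring_scheme \<Rightarrow> bool" where
  "idempotent_in e R \<longleftrightarrow> e \<in> carrier R \<and> e \<otimes>\<^bsub>R\<^esub> e = e"

definition idempotents_lift :: "('a, 'b) ring_scheme \<Rightarrow> 'a set \<Rightarrow> bool" where
  "idempotents_lift R J \<longleftrightarrow>
     (\<forall>E. idempotent_in E (R Quot J) \<longrightarrow> (\<exists>e. idempotent_in e R \<and> E = J +>\<^bsub>R\<^esub> e))"

definition semiperfect_ring :: "('a, 'b) ring_scheme \<Rightarrow> bool" where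
  "semiperfect_ring R \<longleftrightarrow> ring R \<and> artinian_ring (R Quot jacobson_radical R) \<and>
     idempotents_lift R (jacobson_radical R)"


section \<open>Free associative unital algebras\<close>

text \<open>The words over \<open>'x\<close>, written additively because the product of
  \<^typ>\<open>'m \<Rightarrow>\<^sub>0 'k\<close> is the convolution over the additive monoid \<open>'m\<close>. So
  \<open>'x fword \<Rightarrow>\<^sub>0 'k\<close> is the free associative unital algebra on the set of all
  elements of \<open>'x\<close>.\<close>

datatype 'x fword = FWord (letters: "'x list")

instantiation fword :: (type) monoid_add
begin

definition zero_fword :: "'a fword" where
  "0 = FWord []"

definition plus_fword :: "'a fword \<Rightarrow> 'a fword \<Rightarrow> 'a fword" where
  "u + v = FWord (letters u @ letters v)"

instance
  by standard (simp_all add: zero_fword_def plus_fword_def)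

end

definition fgen :: "'x \<Rightarrow> 'x fword \<Rightarrow>\<^sub>0 'k::field" where
  "fgen x = Poly_Mapping.single (FWord [x]) 1"

definition fscalar :: "'k \<Rightarrow> 'x fword \<Rightarrow>\<^sub>0 'k::field" where
  "fscalar c = Poly_Mapping.single 0 c"


section \<open>Restricted Lie algebras\<close>

text \<open>As in \<^locale>\<open>vector_space\<close>, the underlying set is a whole type, whose addition
  is that of the Lie algebra.\<close>

locale lie_algebra = vector_space scale
  for scale :: "'k::field \<Rightarrow> 'v::ab_group_add \<Rightarrow> 'v" +
  fixes bracket :: "'v \<Rightarrow> 'v \<Rightarrow> 'v"
  assumes bracket_add_left: "bracket (x + y) z = bracket x z + bracket y z"
    and bracket_add_right: "bracket x (y + z) = bracket x y + bracket x z"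
    and bracket_scale_left: "bracket (scale c x) y = scale c (bracket x y)"
    and bracket_scale_right: "bracket x (scale c y) = scale c (bracket x y)"
    and bracket_self: "bracket x x = 0"
    and jacobi: "bracket x (bracket y z) + bracket y (bracket z x) + bracket z (bracket x y) = 0"
begin

definition abelian_lie :: bool where
  "abelian_lie \<longleftrightarrow> (\<forall>x y. bracket x y = 0)"

definition infinite_dimensional :: bool where
  "infinite_dimensional \<longleftrightarrow> \<not> (\<exists>B. finite B \<and> span B = UNIV)"

text \<open>\<open>ad_coeff x y n i\<close> is the coefficient of \<open>\<lambda>\<^sup>i\<close> in \<open>(ad (\<lambda>x + y))\<^sup>n (x)\<close>,
  for an indeterminate \<open>\<lambda>\<close>.\<close>

fun ad_coeff :: "'v \<Rightarrow> 'v \<Rightarrow> nat \<Rightarrow> nat \<Rightarrow> 'v" where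
  "ad_coeff x y 0 i = (if i = 0 then x else 0)"
| "ad_coeff x y (Suc n) 0 = bracket y (ad_coeff x y n 0)"
| "ad_coeff x y (Suc n) (Suc i) = bracket x (ad_coeff x y n i) + bracket y (ad_coeff x y n (Suc i))"

text \<open>Jacobson's \<open>s\<^sub>i(x, y)\<close>: \<open>i s\<^sub>i(x, y)\<close> is the coefficient of \<open>\<lambda>\<^sup>i\<^sup>-\<^sup>1\<close> in
  \<open>(ad (\<lambda>x + y))\<^sup>p\<^sup>-\<^sup>1 (x)\<close>. It is used for \<open>0 < i < p\<close> only.\<close>

definition jacobson_s :: "nat \<Rightarrow> 'v \<Rightarrow> 'v \<Rightarrow> 'v" where
  "jacobson_s i x y = scale (inverse (of_nat i)) (ad_coeff x y (CHAR('k) - 1) (i - 1))"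

end

locale restricted_lie_algebra = lie_algebra scale bracket
  for scale :: "'k::field \<Rightarrow> 'v::ab_group_add \<Rightarrow> 'v" and bracket :: "'v \<Rightarrow> 'v \<Rightarrow> 'v" +
  fixes pmap :: "'v \<Rightarrow> 'v"
  assumes char_pos: "CHAR('k) > 0"
    and pmap_scale: "pmap (scale c x) = scale (c ^ CHAR('k)) (pmap x)"
    and pmap_ad: "bracket (pmap x) y = (bracket x ^^ CHAR('k)) y"
    and pmap_add: "pmap (x + y) = pmap x + pmap y + (\<Sum>i = 1..<CHAR('k). jacobson_s i x y)"
begin

definition p_nilpotent :: "'v \<Rightarrow> bool" where
  "p_nilpotent x \<longleftrightarrow> (\<exists>n\<ge>1. (pmap ^^ n) x = 0)"

definition p_nil :: "'v set \<Rightarrow> bool" where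
  "p_nil S \<longleftrightarrow> (\<forall>x\<in>S. p_nilpotent x)"

definition restricted_ideal :: "'v set \<Rightarrow> bool" where
  "restricted_ideal I \<longleftrightarrow> subspace I \<and> (\<forall>x. \<forall>y\<in>I. bracket x y \<in> I) \<and> (\<forall>y\<in>I. pmap y \<in> I)"

text \<open>The sum of a family of subspaces is the span of its union.\<close>

definition p_radical :: "'v set" where
  "p_radical = span (\<Union>{I. restricted_ideal I \<and> p_nil I})"

text \<open>The restricted enveloping algebra \<open>u(L)\<close> is presented by generators, one for
  each element of \<open>L\<close>, and relations. The first two families make the canonical map from
  \<open>L\<close> linear, and so turn the free algebra on the set \<open>L\<close> into the tensor algebra of \<open>L\<close>.
  The third gives the universal enveloping algebra, and the last identifies the \<open>p\<close>-th
  power of \<open>x\<close> with the image of \<open>x\<close> under the \<open>p\<close>-map.\<close>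

definition u_relations :: "('v fword \<Rightarrow>\<^sub>0 'k) set" where
  "u_relations =
     {fgen (x + y) - (fgen x + fgen y) | x y. True} \<union>
     {fgen (scale c x) - fscalar c * fgen x | c x. True} \<union>
     {fgen x * fgen y - fgen y * fgen x - fgen (bracket x y) | x y. True} \<union>
     {fgen x ^ CHAR('k) - fgen (pmap x) | x. True}"

definition restricted_enveloping_algebra :: "('v fword \<Rightarrow>\<^sub>0 'k) set ring" where
  "restricted_enveloping_algebra =
     (let F = ring_of_type_algebra in F Quot (Idl\<^bsub>F\<^esub> u_relations))"

end


section \<open>Rational functions in countably many indeterminates\<close>

text \<open>\<^typ>\<open>nat \<Rightarrow>\<^sub>0 nat\<close> is the type of monomials in the indeterminates indexed by
  \<^typ>\<open>nat\<close>, so \<open>(nat \<Rightarrow>\<^sub>0 nat) \<Rightarrow>\<^sub>0 'f\<close> is the polynomial ring over \<open>'f\<close> in these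
  indeterminates.\<close>

type_synonym 'f rat_funs = "((nat \<Rightarrow>\<^sub>0 nat) \<Rightarrow>\<^sub>0 'f) fract"

end

theory Submission
  imports Defs
begin

text \<open>
  Let \<open>L\<close> have a basis \<open>x\<^sub>0, x\<^sub>1, \<dots>\<close> over \<open>K\<close>, the zero bracket, and the \<open>p\<close>-map
  \<open>x \<mapsto> q(x) x\<^sub>0\<close> for the quadratic form \<open>q(\<Sum> a\<^sub>i x\<^sub>i) = \<Sum> s\<^sub>i a\<^sub>i\<^sup>2\<close>, where \<open>s\<^sub>0 = 1\<close> and the
  other \<open>s\<^sub>i\<close> are the indeterminates. In characteristic 2 the form \<open>q\<close> is additive, which
  makes this a \<open>p\<close>-map on the abelian Lie algebra \<open>L\<close>.

  The \<open>p\<close>-radical vanishes because \<open>q\<close> is anisotropic: the \<open>s\<^sub>i\<close> are linearly independent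
  over the subfield \<open>K\<^sup>2\<close> of squares. After clearing denominators, a relation has the form
  \<open>\<Sum> s\<^sub>i b\<^sub>i\<^sup>2 = 0\<close> with polynomials \<open>b\<^sub>i\<close>. All exponents in \<open>b\<^sub>i\<^sup>2\<close> are even, so the
  monomials of \<open>s\<^sub>i b\<^sub>i\<^sup>2\<close> and those of \<open>s\<^sub>j b\<^sub>j\<^sup>2\<close> have different exponent parities when
  \<open>i \<noteq> j\<close>, and nothing cancels (\<open>monomials_square_independent\<close>). Hence the \<open>p\<close>-map
  sends only \<open>0\<close> to \<open>0\<close>, and no other element is \<open>p\<close>-nilpotent.

  The algebra \<open>u(L)\<close> is commutative, and the class \<open>e\<close> of \<open>x\<^sub>0\<close> is idempotent because
  \<open>x\<^sub>0\<close> is fixed by the \<open>p\<close>-map. Squares of generators lie in \<open>K e\<close>, and squaring is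
  additive and multiplicative, so every square in \<open>u(L)\<close> lies in \<open>K e + K f\<close>, where
  \<open>f = 1 - e = 1 + e\<close>. For \<open>g \<in> {e, f}\<close> and \<open>a \<in> u(L)\<close> this gives \<open>g a\<^sup>2 = c g\<close> with
  \<open>c \<in> K\<close>: if \<open>c = 0\<close>, then \<open>g a\<close> has square zero, and otherwise \<open>g a\<close> has the inverse
  \<open>c\<^sup>-\<^sup>1 g a\<close> in the ring \<open>g u(L)\<close>, whose identity is \<open>g\<close>. So the two factors \<open>e u(L)\<close>
  and \<open>f u(L)\<close> are local (or zero), and a product of two such rings is semiperfect
  (\<open>semiperfect_ring_if_two_local_corners\<close>, \<open>u_semiperfect_if_pmap_in_line\<close>).
\<close>

section \<open>Finitely supported functions\<close>

text \<open>Building a finitely supported function by adding one term at a time suits the ring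
  structure better than building it by updates.\<close>

lemma poly_mapping_add_induct [case_names zero add]:
  assumes zero: "P 0"
    and add: "\<And>p w c. P p \<Longrightarrow> P (p + Poly_Mapping.single w c)"
  shows "P (p :: 'a \<Rightarrow>\<^sub>0 'b::monoid_add)"
proof (induction p rule: update_induct)
  case const
  then show ?case by (rule zero)
next
  case (update p w c)
  have "Poly_Mapping.update w c p = p + Poly_Mapping.single w c"
    using update(1)
    by (intro poly_mapping_eqI)
       (auto simp: lookup_update lookup_add lookup_single in_keys_iff when_def)
  then show ?case using add[OF update(3)] by simp
qed

lemma double_eq_0_CHAR_2:
  assumes "CHAR('k::field) = 2"
  shows "(c :: 'k) + c = 0"
proof -
  have "(2::'k) = 0"
    using of_nat_CHAR[where 'a = 'k] by (simp add: assms)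
  then show ?thesis by (simp flip: mult_2)
qed

lemma double_poly_mapping_eq_0:
  assumes "CHAR('k::field) = 2"
  shows "(p :: 'm \<Rightarrow>\<^sub>0 'k) + p = 0"
  by (rule poly_mapping_eqI) (simp only: lookup_add double_eq_0_CHAR_2[OF assms] lookup_zero)

section \<open>A criterion for commutative rings to be semiperfect\<close>

lemma (in ring) artinian_ring_if_finitely_many_one_sided_ideals:
  assumes "finite {I. left_ideal I R}" and "finite {I. right_ideal I R}"
  shows "artinian_ring R"
proof -
  have stable: "\<exists>m. \<forall>n\<ge>m. I n = I m"
    if fin: "finite F" and chain: "\<forall>n. I n \<in> F \<and> I (Suc n) \<subseteq> I n"
    for F :: "'a set set" and I :: "nat \<Rightarrow> 'a set"
  proof -
    have "finite (range I)"
      using chain by (intro finite_subset[OF _ fin]) blast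
    \<comment> \<open>A descending chain with finitely many values reaches its least value.\<close>
    then have "\<exists>S\<in>range I. \<forall>T\<in>range I. T \<subseteq> S \<longrightarrow> S = T"
      by (rule finite_has_minimal) simp
    then obtain m where "\<forall>T\<in>range I. T \<subseteq> I m \<longrightarrow> I m = T"
      by (elim bexE rangeE) simp
    then have m: "I n = I m" if "I n \<subseteq> I m" for n
      using that by (metis rangeI)
    have "I n \<subseteq> I m" if "m \<le> n" for n
      by (rule lift_Suc_antimono_le[OF _ that]) (use chain in blast)
    then show ?thesis using m by (intro exI[of _ m]) simp
  qed
  show ?thesis
    unfolding artinian_ring_def
  proof (intro conjI allI impI)
    show "ring R" by (rule ring_axioms)
  qed (rule stable[OF assms(1)] stable[OF assms(2)], simp)+
qed

lemma (in cring) left_ideal_eq_ideal: "left_ideal I R \<longleftrightarrow> ideal I R"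
proof
  assume "left_ideal I R"
  then show "ideal I R"
    unfolding left_ideal_def
    by (metis additive_subgroup.a_Hcarr additive_subgroup.a_subgroup idealI m_comm ring_axioms)
next
  assume "ideal I R"
  then show "left_ideal I R"
    unfolding left_ideal_def by (simp add: ideal.I_l_closed ideal.axioms(1))
qed

lemma (in cring) right_ideal_eq_ideal: "right_ideal I R \<longleftrightarrow> ideal I R"
proof
  assume "right_ideal I R"
  then show "ideal I R"
    unfolding right_ideal_def
    by (metis additive_subgroup.a_Hcarr additive_subgroup.a_subgroup idealI m_comm ring_axioms)
next
  assume "ideal I R"
  then show "right_ideal I R"
    unfolding right_ideal_def by (simp add: ideal.I_r_closed ideal.axioms(1))
qed

lemma (in cring) maximal_left_ideal_imp_primeideal:
  assumes "maximal_left_ideal M R"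
  shows "primeideal M R"
proof -
  have "maximalideal M R"
    using assms unfolding maximal_left_ideal_def left_ideal_eq_ideal
    by (intro maximalidealI) auto
  then show ?thesis by (rule maximalideal_prime)
qed

lemma (in cring) jacobson_radical_ideal: "ideal (jacobson_radical R) R"
proof -
  have "ideal (\<Inter>(insert (carrier R) {M. maximal_left_ideal M R})) R"
    using oneideal unfolding maximal_left_ideal_def left_ideal_eq_ideal
    by (intro i_Intersect) auto
  then show ?thesis by (simp add: jacobson_radical_def)
qed

text \<open>Maximal ideals of a commutative ring are prime, and a prime ideal contains every
  nilpotent element.\<close>

lemma (in cring) nilpotent_in_jacobson_radical:
  assumes "x \<in> carrier R" and "x [^] (n::nat) = \<zero>"
  shows "x \<in> jacobson_radical R"
proof -
  have "x \<in> M" if "maximal_left_ideal M R" for M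
  proof -
    interpret primeideal M R
      using that by (rule maximal_left_ideal_imp_primeideal)
    have "x \<in> M" if "x [^] k \<in> M" for k :: nat
      using that
    proof (induction k)
      case 0
      then have "M = carrier R" by (intro one_imp_carrier) simp
      then show ?case using I_notcarr by simp
    next
      case (Suc k)
      then have "x [^] k \<otimes> x \<in> M" by simp
      then show ?case using I_prime[of "x [^] k" x] assms(1) Suc.IH by blast
    qed
    from this[of n] show ?thesis using assms(2) by simp
  qed
  then show ?thesis using assms(1) by (simp add: jacobson_radical_def)
qed

text \<open>An ideal \<open>I\<close> is recovered from \<open>I \<inter> {e, f}\<close>: if some \<open>g x \<in> I\<close> with \<open>g \<in> {e, f}\<close> is
  nonzero, then it can be multiplied to \<open>g\<close>, so \<open>g \<in> I\<close>. Hence there are at most four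
  ideals. Similarly, if \<open>x\<close> is idempotent and \<open>g x y = g\<close>, then
  \<open>g x = g x y x = g x\<^sup>2 y = g\<close>, so that \<open>e x \<in> {0, e}\<close> and \<open>f x \<in> {0, f}\<close>.\<close>

lemma (in cring)
  assumes ef: "e \<in> carrier R" "f \<in> carrier R" "e \<oplus> f = \<one>"
    and corner_field: "\<And>g x. g \<in> {e, f} \<Longrightarrow> x \<in> carrier R \<Longrightarrow>
      g \<otimes> x = \<zero> \<or> (\<exists>y\<in>carrier R. g \<otimes> x \<otimes> y = g)"
  shows artinian_ring_if_two_corner_fields: "artinian_ring R"
    and idempotent_if_two_corner_fields: "idempotent_in x R \<Longrightarrow> x \<in> {\<zero>, e, f, \<one>}"
proof -
  have decomp: "x = e \<otimes> x \<oplus> f \<otimes> x" if "x \<in> carrier R" for x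
    using l_distr[OF ef(1,2) that] that ef(3) by simp
  define pattern where "pattern I = I \<inter> {e, f}" for I
  have "inj_on pattern {I. ideal I R}"
  proof (rule inj_onI, clarify)
    fix I K assume "ideal I R" "ideal K R" and eq: "pattern I = pattern K"
    have mem: "x \<in> I' \<longleftrightarrow> x \<in> carrier R \<and> (\<forall>g\<in>{e, f}. g \<otimes> x = \<zero> \<or> g \<in> pattern I')"
      if "ideal I' R" for I' x
    proof -
      interpret I: ideal I' R by fact
      have corner: "g \<otimes> x \<in> I' \<longleftrightarrow> g \<otimes> x = \<zero> \<or> g \<in> I'"
        if "g \<in> {e, f}" "x \<in> carrier R" for g
      proof -
        have gc: "g \<in> carrier R" using that ef by auto
        show ?thesis
        proof
          assume "g \<otimes> x \<in> I'"
          then have "g \<otimes> x \<otimes> y \<in> I'" if "y \<in> carrier R" for y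
            using that by (rule I.I_r_closed)
          then show "g \<otimes> x = \<zero> \<or> g \<in> I'"
            using corner_field[OF that] by fastforce
        next
          assume "g \<otimes> x = \<zero> \<or> g \<in> I'"
          then show "g \<otimes> x \<in> I'"
            using that(2) by (auto intro: I.I_r_closed)
        qed
      qed
      have "x \<in> I' \<longleftrightarrow> x \<in> carrier R \<and> e \<otimes> x \<in> I' \<and> f \<otimes> x \<in> I'"
      proof (intro iffI conjI)
        assume "x \<in> carrier R \<and> e \<otimes> x \<in> I' \<and> f \<otimes> x \<in> I'"
        then show "x \<in> I'" using decomp[of x] I.a_closed by metis
      qed (use ef I.a_Hcarr I.I_l_closed in auto)
      then show ?thesis
        using corner[of e] corner[of f] by (cases "x \<in> carrier R") (simp_all add: pattern_def)
    qed
    show "I = K"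
      unfolding set_eq_iff mem[OF \<open>ideal I R\<close>] mem[OF \<open>ideal K R\<close>] eq by simp
  qed
  moreover have "pattern ` {I. ideal I R} \<subseteq> Pow {e, f}"
    unfolding pattern_def by blast
  ultimately have "finite {I. ideal I R}"
    by (rule inj_on_finite) simp
  then show "artinian_ring R"
    by (intro artinian_ring_if_finitely_many_one_sided_ideals)
       (simp_all add: left_ideal_eq_ideal right_ideal_eq_ideal)
  show "x \<in> {\<zero>, e, f, \<one>}" if "idempotent_in x R"
  proof -
    have x: "x \<in> carrier R" "x \<otimes> x = x"
      using that by (auto simp: idempotent_in_def)
    have "g \<otimes> x = \<zero> \<or> g \<otimes> x = g" if g: "g \<in> {e, f}" for g
    proof -
      have gc: "g \<in> carrier R" using g ef by auto
      consider "g \<otimes> x = \<zero>" | y where "y \<in> carrier R" "g \<otimes> x \<otimes> y = g"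
        using corner_field[OF g x(1)] by blast
      then show ?thesis
      proof cases
        case 2
        then have "g \<otimes> x = g \<otimes> x \<otimes> y \<otimes> x" by (simp only:)
        also have "\<dots> = g \<otimes> (x \<otimes> x) \<otimes> y"
          using 2(1) x(1) gc by algebra
        also have "\<dots> = g" using 2 x(2) by simp
        finally show ?thesis by simp
      qed simp
    qed
    from this[of e] this[of f] show ?thesis
      using decomp[OF x(1)] ef by auto
  qed
qed

text \<open>Modulo the Jacobson radical \<open>J\<close>, the nilpotent alternative of \<open>corner_local\<close> becomes
  \<open>g x = 0\<close>, so the previous lemma applies to \<open>R/J\<close>. It leaves only the idempotents
  \<open>0\<close>, \<open>e\<close>, \<open>f\<close> and \<open>1\<close> of \<open>R/J\<close>, and these are visibly the images of idempotents of
  \<open>R\<close>.\<close>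

lemma (in cring) semiperfect_ring_if_two_local_corners:
  assumes ef: "e \<in> carrier R" "f \<in> carrier R" "e \<oplus> f = \<one>" "e \<otimes> f = \<zero>"
    and corner_local: "\<And>g x. g \<in> {e, f} \<Longrightarrow> x \<in> carrier R \<Longrightarrow>
      (\<exists>n::nat. (g \<otimes> x) [^] n = \<zero>) \<or> (\<exists>y\<in>carrier R. g \<otimes> x \<otimes> y = g)"
  shows "semiperfect_ring R"
proof -
  let ?J = "jacobson_radical R"
  let ?q = "a_r_coset R ?J"
  interpret J: ideal ?J R by (rule jacobson_radical_ideal)
  interpret Q: cring "R Quot ?J"
    using cring_axioms by (rule J.quotient_is_cring)
  interpret h: ring_hom_ring R "R Quot ?J" ?q
    by (rule J.rcos_ring_hom_ring)
  have surj: "\<exists>x\<in>carrier R. Z = ?q x" if "Z \<in> carrier (R Quot ?J)" for Z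
    using that unfolding FactRing_def A_RCOSETS_def' by simp
  have sum: "(?q e) \<oplus>\<^bsub>R Quot ?J\<^esub> (?q f) = \<one>\<^bsub>R Quot ?J\<^esub>"
    unfolding h.hom_add[OF ef(1,2), symmetric] ef(3) by (rule h.hom_one)
  have corner: "G \<otimes>\<^bsub>R Quot ?J\<^esub> Z = \<zero>\<^bsub>R Quot ?J\<^esub> \<or>
      (\<exists>Y\<in>carrier (R Quot ?J). G \<otimes>\<^bsub>R Quot ?J\<^esub> Z \<otimes>\<^bsub>R Quot ?J\<^esub> Y = G)"
    if G: "G \<in> {?q e, ?q f}" and Z: "Z \<in> carrier (R Quot ?J)" for G Z
  proof -
    obtain g where g: "g \<in> {e, f}" "G = ?q g" using G by blast
    obtain x where x: "x \<in> carrier R" "Z = ?q x" using surj[OF Z] by blast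
    have gc: "g \<in> carrier R" using g ef by auto
    from corner_local[OF g(1) x(1)] show ?thesis
    proof
      assume "\<exists>n::nat. (g \<otimes> x) [^] n = \<zero>"
      then have "g \<otimes> x \<in> ?J"
        using nilpotent_in_jacobson_radical[OF m_closed[OF gc x(1)]] by blast
      then have "?q (g \<otimes> x) = \<zero>\<^bsub>R Quot ?J\<^esub>"
        unfolding FactRing_def by (simp add: J.a_rcos_const)
      then show ?thesis unfolding x(2) g(2) h.hom_mult[OF gc x(1)] by (rule disjI1)
    next
      assume "\<exists>y\<in>carrier R. g \<otimes> x \<otimes> y = g"
      then obtain y where y: "y \<in> carrier R" "g \<otimes> x \<otimes> y = g" by blast
      have "?q g \<otimes>\<^bsub>R Quot ?J\<^esub> ?q x \<otimes>\<^bsub>R Quot ?J\<^esub> ?q y = ?q (g \<otimes> x \<otimes> y)"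
        unfolding h.hom_mult[OF gc x(1)] h.hom_mult[OF m_closed[OF gc x(1)] y(1)] by (rule refl)
      then show ?thesis unfolding x(2) g(2) y(2) using h.hom_closed[OF y(1)] by blast
    qed
  qed
  have idem: "idempotent_in g R" if "g \<in> {\<zero>, e, f, \<one>}" for g
  proof -
    have "e \<otimes> e = e \<otimes> (e \<oplus> f)" "f \<otimes> f = (e \<oplus> f) \<otimes> f"
      using ef(1,2,4) by (simp_all add: r_distr l_distr)
    then have "e \<otimes> e = e" "f \<otimes> f = f" using ef(1,2,3) by simp_all
    then show ?thesis using that ef by (auto simp: idempotent_in_def)
  qed
  have "idempotents_lift R ?J"
    unfolding idempotents_lift_def
  proof (intro allI impI)
    fix E assume E: "idempotent_in E (R Quot ?J)"
    have "E \<in> {\<zero>\<^bsub>R Quot ?J\<^esub>, ?q e, ?q f, \<one>\<^bsub>R Quot ?J\<^esub>}"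
      by (rule Q.idempotent_if_two_corner_fields[OF h.hom_closed[OF ef(1)] h.hom_closed[OF ef(2)] sum _ E]) (rule corner)
    then have "\<exists>g\<in>{\<zero>, e, f, \<one>}. E = ?q g"
      unfolding h.hom_zero[symmetric] h.hom_one[symmetric] by blast
    then show "\<exists>g. idempotent_in g R \<and> E = ?q g" using idem by blast
  qed
  moreover have "artinian_ring (R Quot ?J)"
    by (rule Q.artinian_ring_if_two_corner_fields[OF h.hom_closed[OF ef(1)] h.hom_closed[OF ef(2)] sum]) (rule corner)
  ultimately show ?thesis
    using ring_axioms by (simp add: semiperfect_ring_def)
qed

section \<open>Restricted enveloping algebras\<close>

lemma fscalar_add: "fscalar (c + d) = fscalar c + fscalar d"
  by (simp add: fscalar_def single_add)

lemma fscalar_mult: "fscalar (c * d) = fscalar c * fscalar d"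
  by (simp add: fscalar_def mult_single)

lemma fscalar_0: "fscalar 0 = 0" and fscalar_1: "fscalar 1 = 1"
  by (simp_all add: fscalar_def)

text \<open>Properties of the free algebra that only hold modulo relations are proved by peeling off
  the first letter of each word.\<close>

lemma free_algebra_induct [case_names scalar gen add]:
  fixes P :: "('x fword \<Rightarrow>\<^sub>0 'k::field) \<Rightarrow> bool"
  assumes scalar: "\<And>c. P (fscalar c)"
    and gen: "\<And>x a. P a \<Longrightarrow> P (fgen x * a)"
    and add: "\<And>a b. P a \<Longrightarrow> P b \<Longrightarrow> P (a + b)"
  shows "P a"
proof -
  have word: "P (Poly_Mapping.single (FWord xs) c)" for xs c
  proof (induction xs)
    case Nil
    then show ?case using scalar[of c] by (simp add: fscalar_def zero_fword_def)
  next
    case (Cons x xs)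
    have "Poly_Mapping.single (FWord (x # xs)) c = fgen x * Poly_Mapping.single (FWord xs) c"
      by (simp add: fgen_def mult_single plus_fword_def)
    then show ?case using gen[OF Cons] by simp
  qed
  show ?thesis
  proof (induction a rule: poly_mapping_add_induct)
    case zero
    then show ?case using scalar[of 0] by (simp add: fscalar_0)
  next
    case (add a w c)
    then show ?case using word[of "letters w" c] assms(3) by simp
  qed
qed

lemma fscalar_commute: "fscalar c * a = a * fscalar c"
proof (induction a rule: free_algebra_induct)
  case (scalar d)
  then show ?case by (simp flip: fscalar_mult add: mult.commute)
next
  case (gen x a)
  have "fscalar c * fgen x = fgen x * fscalar c"
    by (simp add: fscalar_def fgen_def mult_single)
  then show ?case using gen by (metis mult.assoc)
next
  case (add a b)
  then show ?case by (simp add: distrib_left distrib_right)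
qed

lemma ring_ring_of_type_algebra: "ring (ring_of_type_algebra :: 'a::ring_1 ring)"
proof -
  have "\<exists>y. x + y = 0" for x :: 'a
    using add.right_inverse by blast
  then show ?thesis
    unfolding ring_of_type_algebra_def
    by unfold_locales (auto simp: algebra_simps Units_def)
qed

context restricted_lie_algebra
begin

text \<open>Computations in \<open>u(L)\<close> are carried out on representatives in the free algebra, where the
  simplifier knows the ring laws; equality of their classes replaces congruence modulo
  the ideal of relations.\<close>

abbreviation u_ideal :: "('v fword \<Rightarrow>\<^sub>0 'k) set" where
  "u_ideal \<equiv> Idl\<^bsub>ring_of_type_algebra\<^esub> u_relations"

definition u_class :: "('v fword \<Rightarrow>\<^sub>0 'k) \<Rightarrow> ('v fword \<Rightarrow>\<^sub>0 'k) set" where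
  "u_class = a_r_coset ring_of_type_algebra u_ideal"

lemma ideal_u_ideal:
  "ideal u_ideal (ring_of_type_algebra :: ('v fword \<Rightarrow>\<^sub>0 'k) ring)"
  by (rule ring.genideal_ideal[OF ring_ring_of_type_algebra]) (simp add: ring_of_type_algebra_def)

lemma u_class_hom:
  "ring_hom_ring ring_of_type_algebra restricted_enveloping_algebra u_class"
  unfolding restricted_enveloping_algebra_def u_class_def Let_def
  using ideal_u_ideal by (rule ideal.rcos_ring_hom_ring)

lemma u_ring: "ring restricted_enveloping_algebra"
  using u_class_hom by (rule ring_hom_ring.axioms)

lemma u_class_closed: "u_class a \<in> carrier restricted_enveloping_algebra"
  using ring_hom_ring.homh[OF u_class_hom]
  by (auto simp: ring_hom_def ring_of_type_algebra_def)

lemma u_class_mult: "u_class (a * b) = u_class a \<otimes>\<^bsub>restricted_enveloping_algebra\<^esub> u_class b"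
  and u_class_add: "u_class (a + b) = u_class a \<oplus>\<^bsub>restricted_enveloping_algebra\<^esub> u_class b"
  and u_class_one: "u_class 1 = \<one>\<^bsub>restricted_enveloping_algebra\<^esub>"
  using ring_hom_ring.homh[OF u_class_hom]
  by (auto simp: ring_hom_def ring_of_type_algebra_def)

lemma u_class_zero: "u_class 0 = \<zero>\<^bsub>restricted_enveloping_algebra\<^esub>"
proof -
  interpret U: ring restricted_enveloping_algebra by (rule u_ring)
  have "u_class 0 \<oplus>\<^bsub>restricted_enveloping_algebra\<^esub> u_class 0 = u_class 0"
    using u_class_add[of 0 0] by simp
  then show ?thesis using u_class_closed[of 0] by (metis U.add.l_cancel_one)
qed

lemma u_class_surj:
  "A \<in> carrier restricted_enveloping_algebra \<Longrightarrow> \<exists>a. A = u_class a"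
  unfolding restricted_enveloping_algebra_def Let_def FactRing_def A_RCOSETS_def' u_class_def
  by auto

lemma u_class_cong_mult:
  "u_class a = u_class a' \<Longrightarrow> u_class b = u_class b' \<Longrightarrow> u_class (a * b) = u_class (a' * b')"
  by (simp only: u_class_mult)

lemma u_class_cong_add:
  "u_class a = u_class a' \<Longrightarrow> u_class b = u_class b' \<Longrightarrow> u_class (a + b) = u_class (a' + b')"
  by (simp only: u_class_add)

lemma u_class_eqI:
  assumes "a - b \<in> u_relations"
  shows "u_class a = u_class b"
proof -
  interpret I: ideal u_ideal "ring_of_type_algebra :: ('v fword \<Rightarrow>\<^sub>0 'k) ring"
    by (rule ideal_u_ideal)
  have "a - b \<in> u_ideal"
    using ring.genideal_self[OF ring_ring_of_type_algebra, of u_relations] assms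
    by (auto simp: ring_of_type_algebra_def)
  then have "a \<in> a_r_coset ring_of_type_algebra u_ideal b"
    unfolding a_r_coset_def' by (force simp: ring_of_type_algebra_def)
  then show ?thesis
    unfolding u_class_def
    by (intro I.a_repr_independence[symmetric] I.a_subgroup) (simp_all add: ring_of_type_algebra_def)
qed

lemma u_class_scale: "u_class (fgen (scale c x)) = u_class (fscalar c * fgen x)"
  by (rule u_class_eqI) (auto simp: u_relations_def)

lemma u_class_power: "u_class (fgen x ^ CHAR('k)) = u_class (fgen (pmap x))"
  by (rule u_class_eqI) (auto simp: u_relations_def)

text \<open>The relations equate the commutator with \<open>fgen (bracket x y) = fgen 0\<close>, which is not zero
  in the free algebra; its class is zero because \<open>0 = scale 0 0\<close>.\<close>

lemma u_class_gen_commute: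
  assumes "bracket x y = 0"
  shows "u_class (fgen x * fgen y) = u_class (fgen y * fgen x)"
proof -
  have "u_class (fgen (bracket x y)) = u_class 0"
    using u_class_scale[of 0 0] by (simp add: assms fscalar_0)
  moreover have "u_class (fgen x * fgen y - fgen y * fgen x) = u_class (fgen (bracket x y))"
    by (rule u_class_eqI) (auto simp: u_relations_def)
  ultimately have "u_class (fgen y * fgen x + (fgen x * fgen y - fgen y * fgen x)) =
      u_class (fgen y * fgen x + 0)"
    by (intro u_class_cong_add) simp_all
  then show ?thesis by simp
qed

text \<open>Generators commute with each other, hence with all elements, hence all elements commute:
  two inductions over the free algebra.\<close>

lemma u_cring_if_abelian:
  assumes ab: "abelian_lie"
  shows "cring restricted_enveloping_algebra"
proof -
  have gen_comm: "u_class (fgen x * b) = u_class (b * fgen x)" for x b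
  proof (induction b rule: free_algebra_induct)
    case (scalar c)
    then show ?case by (simp add: fscalar_commute)
  next
    case (gen y b)
    have "u_class (fgen x * (fgen y * b)) = u_class (fgen y * fgen x * b)"
      unfolding mult.assoc[symmetric] using ab
      by (intro u_class_cong_mult u_class_gen_commute refl) (simp add: abelian_lie_def)
    also have "\<dots> = u_class (fgen y * (b * fgen x))"
      unfolding mult.assoc by (rule u_class_cong_mult[OF refl gen])
    finally show ?case by (simp add: mult.assoc)
  next
    case (add a b)
    then show ?case unfolding distrib_left distrib_right by (rule u_class_cong_add)
  qed
  have comm: "u_class (a * b) = u_class (b * a)" for a b
  proof (induction a rule: free_algebra_induct)
    case (scalar c)
    then show ?case by (simp add: fscalar_commute)
  next
    case (gen x a)
    have "u_class (fgen x * a * b) = u_class (fgen x * (b * a))"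
      unfolding mult.assoc
      by (rule u_class_cong_mult[OF refl gen])
    also have "\<dots> = u_class (b * fgen x * a)"
      unfolding mult.assoc[symmetric] by (rule u_class_cong_mult[OF gen_comm refl])
    finally show ?case by (simp only: mult.assoc)
  next
    case (add a a')
    then show ?case unfolding distrib_left distrib_right by (rule u_class_cong_add)
  qed
  show ?thesis
  proof (rule cringI)
    show "abelian_group restricted_enveloping_algebra"
      using u_ring by (rule ring.is_abelian_group)
    show "comm_monoid restricted_enveloping_algebra"
    proof (rule monoid.monoid_comm_monoidI)
      show "monoid restricted_enveloping_algebra"
        using u_ring by (rule ring.is_monoid)
      fix A B assume "A \<in> carrier restricted_enveloping_algebra" "B \<in> carrier restricted_enveloping_algebra"
      then obtain a b where "A = u_class a" "B = u_class b" using u_class_surj by blast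
      then show "A \<otimes>\<^bsub>restricted_enveloping_algebra\<^esub> B = B \<otimes>\<^bsub>restricted_enveloping_algebra\<^esub> A"
        using comm[of a b] by (simp add: u_class_mult)
    qed
  qed (rule ring.ring_simprules(13)[OF u_ring])
qed

text \<open>Since \<open>u(L)\<close> is commutative of characteristic 2, squaring is additive. The squares of
  generators are multiples of the idempotent \<open>e\<close>, so all squares are combinations of
  \<open>e\<close> and \<open>f = 1 + e\<close>, and \<open>g a\<^sup>2 = c g\<close> for \<open>g \<in> {e, f}\<close> and some scalar \<open>c\<close>. This decides
  whether \<open>g a\<close> is nilpotent or invertible in its corner.\<close>

lemma u_semiperfect_if_pmap_in_line:
  assumes ab: "abelian_lie" and char2: "CHAR('k) = 2"
    and e_fixed: "pmap e = e" and pmap_line: "\<And>x. \<exists>c. pmap x = scale c e"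
  shows "semiperfect_ring restricted_enveloping_algebra"
proof -
  interpret U: cring restricted_enveloping_algebra
    using ab by (rule u_cring_if_abelian)
  have comm: "u_class (a * b) = u_class (b * a)" for a b
    using U.m_comm u_class_closed by (simp add: u_class_mult)
  have interchange: "u_class ((a * b) * (c * d)) = u_class ((a * c) * (b * d))" for a b c d
  proof -
    have "u_class (a * ((b * c) * d)) = u_class (a * ((c * b) * d))"
      by (intro u_class_cong_mult refl comm)
    then show ?thesis by (simp only: mult.assoc)
  qed
  have double: "a + a = 0" for a :: "'v fword \<Rightarrow>\<^sub>0 'k"
    using char2 by (rule double_poly_mapping_eq_0)
  let ?E = "fgen e :: 'v fword \<Rightarrow>\<^sub>0 'k"
  \<comment> \<open>The complementary idempotent: \<open>1 + e = 1 - e\<close> in characteristic 2.\<close>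
  let ?F = "1 + ?E"
  have EF_sum: "?E + ?F = 1"
    using double[of ?E] by (simp add: add.left_commute)
  have scalar_left: "g * (fscalar c * a) = fscalar c * (g * a)" for c and g a :: "'v fword \<Rightarrow>\<^sub>0 'k"
    unfolding mult.assoc[symmetric] by (simp only: fscalar_commute)
  have square_gen: "\<exists>c. u_class (fgen x * fgen x) = u_class (fscalar c * ?E)" for x
    using pmap_line[of x] u_class_power[of x] u_class_scale
    by (metis char2 power2_eq_square)
  have E_idem: "u_class (?E * ?E) = u_class ?E"
    using u_class_power[of e] by (simp add: char2 e_fixed power2_eq_square)
  have "u_class (?E * ?F) = u_class (?E + ?E)"
    using u_class_cong_add[OF refl E_idem, of ?E] by (simp add: distrib_left)
  then have EF: "u_class (?E * ?F) = u_class 0" by (simp add: double)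
  have "u_class (?F * ?F) = u_class (?F + ?E * ?F)" by (simp add: distrib_right)
  also have "\<dots> = u_class (?F + 0)" by (rule u_class_cong_add[OF refl EF])
  finally have F_idem: "u_class (?F * ?F) = u_class ?F" by simp
  have square: "\<exists>c d. u_class (a * a) = u_class (fscalar c * ?E + fscalar d * ?F)" for a
  proof (induction a rule: free_algebra_induct)
    case (scalar c)
    have "fscalar (c * c) * ?E + fscalar (c * c) * ?F = fscalar c * fscalar c"
      unfolding distrib_left[symmetric] EF_sum by (simp add: fscalar_mult)
    then show ?case by metis
  next
    case (gen x a)
    obtain c where c: "u_class (fgen x * fgen x) = u_class (fscalar c * ?E)"
      using square_gen by blast
    obtain d d' where d: "u_class (a * a) = u_class (fscalar d * ?E + fscalar d' * ?F)"
      using gen by blast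
    have "u_class (fgen x * a * (fgen x * a)) = u_class ((fgen x * fgen x) * (a * a))"
      by (rule interchange)
    also have "\<dots> = u_class ((fscalar c * ?E) * (fscalar d * ?E + fscalar d' * ?F))"
      by (rule u_class_cong_mult[OF c d])
    also have "\<dots> = u_class (fscalar c * fscalar d * (?E * ?E) + fscalar c * fscalar d' * (?E * ?F))"
      by (simp only: distrib_left mult.assoc scalar_left[of ?E])
    also have "\<dots> = u_class (fscalar c * fscalar d * ?E + fscalar c * fscalar d' * 0)"
      by (intro u_class_cong_add u_class_cong_mult refl E_idem EF)
    also have "\<dots> = u_class (fscalar (c * d) * ?E + fscalar 0 * ?F)"
      by (simp add: fscalar_mult fscalar_0)
    finally show ?case by blast
  next
    case (add a b)
    then obtain c d c' d' where
      a: "u_class (a * a) = u_class (fscalar c * ?E + fscalar d * ?F)" and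
      b: "u_class (b * b) = u_class (fscalar c' * ?E + fscalar d' * ?F)" by blast
    \<comment> \<open>The mixed terms agree modulo the relations and cancel in characteristic 2.\<close>
    have "u_class ((a + b) * (a + b)) = u_class ((a * a + b * b) + (a * b + b * a))"
      by (simp add: distrib_left distrib_right add_ac)
    also have "\<dots> = u_class ((a * a + b * b) + (a * b + a * b))"
      by (intro u_class_cong_add refl comm)
    also have "\<dots> = u_class (a * a + b * b)" by (simp add: double)
    also have "\<dots> = u_class ((fscalar c * ?E + fscalar d * ?F) + (fscalar c' * ?E + fscalar d' * ?F))"
      by (rule u_class_cong_add[OF a b])
    also have "\<dots> = u_class (fscalar (c + c') * ?E + fscalar (d + d') * ?F)"
      by (simp add: fscalar_add distrib_right add_ac)
    finally show ?case by blast
  qed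
  have corner_square: "\<exists>c. u_class (g * (a * a)) = u_class (fscalar c * g)"
    if g: "g \<in> {?E, ?F}" for g a
  proof -
    obtain c d where cd: "u_class (a * a) = u_class (fscalar c * ?E + fscalar d * ?F)"
      using square by blast
    have "u_class (g * (a * a)) = u_class (g * (fscalar c * ?E + fscalar d * ?F))"
      by (rule u_class_cong_mult[OF refl cd])
    also have "\<dots> = u_class (fscalar c * (g * ?E) + fscalar d * (g * ?F))"
      by (simp only: distrib_left scalar_left[of g])
    finally have *: "u_class (g * (a * a)) = u_class (fscalar c * (g * ?E) + fscalar d * (g * ?F))" .
    from g consider "g = ?E" | "g = ?F" by blast
    then show ?thesis
    proof cases
      case 1
      have "u_class (fscalar c * (g * ?E) + fscalar d * (g * ?F)) = u_class (fscalar c * ?E + fscalar d * 0)"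
        unfolding 1 by (intro u_class_cong_add u_class_cong_mult refl E_idem EF)
      with * 1 show ?thesis by auto
    next
      case 2
      have "u_class (fscalar c * (g * ?E) + fscalar d * (g * ?F)) = u_class (fscalar c * 0 + fscalar d * ?F)"
        unfolding 2 using EF comm[of ?F ?E]
        by (intro u_class_cong_add u_class_cong_mult refl F_idem) simp
      with * 2 show ?thesis by auto
    qed
  qed
  have "(\<exists>n::nat. (G \<otimes>\<^bsub>restricted_enveloping_algebra\<^esub> A) [^]\<^bsub>restricted_enveloping_algebra\<^esub> n
          = \<zero>\<^bsub>restricted_enveloping_algebra\<^esub>) \<or>
        (\<exists>B\<in>carrier restricted_enveloping_algebra.
          G \<otimes>\<^bsub>restricted_enveloping_algebra\<^esub> A \<otimes>\<^bsub>restricted_enveloping_algebra\<^esub> B = G)"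
    if G: "G \<in> {u_class ?E, u_class ?F}" and A: "A \<in> carrier restricted_enveloping_algebra" for G A
  proof -
    obtain g where g: "g \<in> {?E, ?F}" "G = u_class g" using G by blast
    obtain a where a: "A = u_class a" using u_class_surj[OF A] by blast
    obtain c where c: "u_class (g * (a * a)) = u_class (fscalar c * g)"
      using corner_square[OF g(1)] by blast
    show ?thesis
    proof (cases "c = 0")
      case True
      have "(G \<otimes>\<^bsub>restricted_enveloping_algebra\<^esub> A) [^]\<^bsub>restricted_enveloping_algebra\<^esub> (2::nat)
          = u_class ((g * a) * (g * a))"
        using u_class_closed by (simp add: numeral_2_eq_2 g(2) a u_class_mult)
      also have "\<dots> = u_class (g * (g * (a * a)))"
        using interchange[of g a g a] by (simp only: mult.assoc)
      also have "\<dots> = u_class (g * (fscalar c * g))"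
        by (rule u_class_cong_mult[OF refl c])
      also have "\<dots> = \<zero>\<^bsub>restricted_enveloping_algebra\<^esub>"
        using True by (simp add: fscalar_0 u_class_zero)
      finally show ?thesis by blast
    next
      case False
      \<comment> \<open>\<open>c\<^sup>-\<^sup>1 a\<close> inverts \<open>g a\<close> in the corner, since \<open>g a\<^sup>2 = c g\<close>.\<close>
      have "u_class (g * a * (a * fscalar (inverse c))) = u_class (g * (a * a) * fscalar (inverse c))"
        by (simp add: mult.assoc)
      also have "\<dots> = u_class ((fscalar c * g) * fscalar (inverse c))"
        by (rule u_class_cong_mult[OF c refl])
      also have "(fscalar c * g) * fscalar (inverse c) = fscalar (c * inverse c) * g"
        unfolding fscalar_mult by (metis fscalar_commute mult.assoc)
      also have "\<dots> = g" using False by (simp add: fscalar_1)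
      finally show ?thesis
        using u_class_closed unfolding g(2) a u_class_mult by blast
    qed
  qed
  then show ?thesis
    using u_class_closed EF EF_sum
    by (intro U.semiperfect_ring_if_two_local_corners[of "u_class ?E" "u_class ?F"])
       (simp_all only: u_class_add[symmetric] u_class_mult[symmetric] u_class_zero[symmetric]
          u_class_one[symmetric])
qed

end

section \<open>Linear independence of monomials over the subfield of squares\<close>

lemma CHAR_rat_funs: "CHAR('f::field rat_funs) = CHAR('f)"
proof (rule CHAR_eqI)
  have *: "(of_nat n :: 'f rat_funs) = 0 \<longleftrightarrow> (of_nat n :: 'f) = 0" for n
    by (simp add: of_nat_fract Zero_fract_def eq_fract flip: single_of_nat)
       (metis lookup_single_eq single_zero)
  show "of_nat CHAR('f) = (0 :: 'f rat_funs)"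
    unfolding * by simp
  show "CHAR('f) dvd n" if "of_nat n = (0 :: 'f rat_funs)" for n
    using that unfolding * by (simp add: of_nat_eq_0_iff_char_dvd)
qed

text \<open>In characteristic 2 the mixed terms of a square cancel, so only doubled exponents
  occur.\<close>

lemma even_exponents_of_square:
  fixes p :: "('m::comm_monoid_add) \<Rightarrow>\<^sub>0 'k::field"
  assumes char2: "CHAR('k) = 2" and "Poly_Mapping.lookup (p * p) m \<noteq> 0"
  shows "\<exists>n. m = n + n"
  using assms(2)
proof (induction p rule: poly_mapping_add_induct)
  case zero
  then show ?case by simp
next
  case (add p w c)
  let ?s = "Poly_Mapping.single w c"
  have "p * ?s + p * ?s = 0"
    using char2 by (rule double_poly_mapping_eq_0)
  then have "(p + ?s) * (p + ?s) = p * p + ?s * ?s"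
    by (simp add: distrib_left distrib_right add_ac mult.commute[of ?s p])
  then have "Poly_Mapping.lookup (p * p) m \<noteq> 0 \<or> Poly_Mapping.lookup (Poly_Mapping.single (w + w) (c * c)) m \<noteq> 0"
    using add.prems by (auto simp: lookup_add mult_single)
  then show ?case
    using add.IH by (auto simp: lookup_single when_def split: if_splits)
qed

lemma lookup_single_times_shift:
  fixes p :: "('m::cancel_comm_monoid_add) \<Rightarrow>\<^sub>0 'k::comm_semiring_1"
  shows "Poly_Mapping.lookup (Poly_Mapping.single t 1 * p) (t + m) = Poly_Mapping.lookup p m"
proof (induction p rule: poly_mapping_add_induct)
  case zero
  then show ?case by simp
next
  case (add p w c)
  then show ?case
    by (simp add: distrib_left lookup_add mult_single lookup_single when_def)
qed

text \<open>By \<open>parity\<close>, the exponents of the \<open>i\<close>-th summand, which are \<open>e i\<close> plus a doubled exponent,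
  do not occur in any other summand. So each summand vanishes separately.\<close>

lemma monomials_square_independent:
  fixes b :: "'i \<Rightarrow> ((nat \<Rightarrow>\<^sub>0 nat) \<Rightarrow>\<^sub>0 'k::field)" and e :: "'i \<Rightarrow> (nat \<Rightarrow>\<^sub>0 nat)"
  assumes char2: "CHAR('k) = 2"
    and parity: "\<And>i j m n. e i + (m + m) = e j + (n + n) \<Longrightarrow> i = j"
    and "finite A" and sum0: "(\<Sum>i\<in>A. Poly_Mapping.single (e i) 1 * (b i * b i)) = 0" and i: "i \<in> A"
  shows "b i = 0"
proof -
  have "Poly_Mapping.lookup (b i * b i) m = 0" for m
  proof (rule ccontr)
    assume nz: "Poly_Mapping.lookup (b i * b i) m \<noteq> 0"
    then obtain n where n: "m = n + n"
      using even_exponents_of_square[OF char2] by blast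
    have other: "Poly_Mapping.lookup (Poly_Mapping.single (e j) 1 * (b j * b j)) (e i + m) = 0" if "j \<noteq> i" for j
    proof (rule ccontr)
      assume "Poly_Mapping.lookup (Poly_Mapping.single (e j) 1 * (b j * b j)) (e i + m) \<noteq> 0"
      then have "e i + m \<in> Poly_Mapping.keys (Poly_Mapping.single (e j) 1 * (b j * b j))"
        by (simp add: in_keys_iff)
      then obtain m' where m': "e i + m = e j + m'" "Poly_Mapping.lookup (b j * b j) m' \<noteq> 0"
        using keys_mult[of "Poly_Mapping.single (e j) 1" "b j * b j"] by (force simp: in_keys_iff)
      then show False
        using even_exponents_of_square[OF char2 m'(2)] parity[of i n j] n that by blast
    qed
    have "0 = (\<Sum>j\<in>A. Poly_Mapping.lookup (Poly_Mapping.single (e j) 1 * (b j * b j)) (e i + m))"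
      using sum0 by (simp flip: lookup_sum)
    also have "\<dots> = (\<Sum>j\<in>{i}. Poly_Mapping.lookup (Poly_Mapping.single (e j) 1 * (b j * b j)) (e i + m))"
      using \<open>finite A\<close> i other by (intro sum.mono_neutral_right) auto
    also have "\<dots> = Poly_Mapping.lookup (b i * b i) m"
      by (simp add: lookup_single_times_shift)
    finally show False using nz by simp
  qed
  then have "b i * b i = 0" by (intro poly_mapping_eqI) simp
  then show ?thesis by simp
qed

lemma common_denominator:
  fixes x :: "'i \<Rightarrow> 'a::idom fract"
  assumes "finite A"
  shows "\<exists>d b. d \<noteq> 0 \<and> (\<forall>i\<in>A. x i * to_fract d = to_fract (b i))"
  using assms
proof (induction A)
  case empty
  show ?case by (intro exI[of _ 1]) simp
next
  case (insert k A)
  then obtain d b where d: "d \<noteq> 0" and b: "\<And>i. i \<in> A \<Longrightarrow> x i * to_fract d = to_fract (b i)"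
    by blast
  obtain a c where c: "x k = Fract a c" "c \<noteq> 0" by (cases "x k") auto
  have "x i * to_fract (d * c) = to_fract ((b(k := a * d)) i * (if i = k then 1 else c))"
    if "i \<in> insert k A" for i
  proof (cases "i = k")
    case True
    then show ?thesis using c by (simp add: to_fract_def eq_fract mult_ac)
  next
    case False
    then have "x i * to_fract d * to_fract c = to_fract (b i) * to_fract c"
      using b that by simp
    then show ?thesis using False by (simp add: mult.assoc)
  qed
  then show ?case using d c(2)
    by (intro exI[of _ "d * c"] exI[of _ "\<lambda>i. (b(k := a * d)) i * (if i = k then 1 else c)"]) auto
qed

text \<open>Multiplying a relation over the field of fractions by the square of a common denominator
  turns it into a relation over the ring.\<close>

lemma fract_square_independent:
  fixes m :: "'i \<Rightarrow> 'a::idom" and x :: "'i \<Rightarrow> 'a fract"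
  assumes ind: "\<And>b i. (\<Sum>i\<in>A. m i * (b i * b i)) = 0 \<Longrightarrow> i \<in> A \<Longrightarrow> b i = 0"
    and fin: "finite A" and sum0: "(\<Sum>i\<in>A. to_fract (m i) * (x i)\<^sup>2) = 0" and i: "i \<in> A"
  shows "x i = 0"
proof -
  obtain d b where d: "d \<noteq> 0" and b: "\<And>i. i \<in> A \<Longrightarrow> x i * to_fract d = to_fract (b i)"
    using common_denominator[OF fin] by blast
  have "to_fract (\<Sum>i\<in>A. m i * (b i * b i)) = (\<Sum>i\<in>A. to_fract (m i) * (x i)\<^sup>2 * (to_fract d)\<^sup>2)"
    unfolding to_fract_sum
  proof (rule sum.cong)
    fix j assume "j \<in> A"
    have "to_fract (m j * (b j * b j)) = to_fract (m j) * (to_fract (b j) * to_fract (b j))" by simp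
    also have "\<dots> = to_fract (m j) * (x j)\<^sup>2 * (to_fract d)\<^sup>2"
      unfolding b[OF \<open>j \<in> A\<close>, symmetric] by (simp only: power2_eq_square mult_ac)
    finally show "to_fract (m j * (b j * b j)) = to_fract (m j) * (x j)\<^sup>2 * (to_fract d)\<^sup>2" .
  qed simp
  also have "\<dots> = 0"
    using sum0 by (simp flip: sum_distrib_right)
  finally have "(\<Sum>i\<in>A. m i * (b i * b i)) = 0"
    by (simp only: to_fract_eq_0_iff)
  then have "b i = 0" using i by (rule ind)
  then have "x i * to_fract d = 0" using b[OF i] by simp
  then show ?thesis using d by simp
qed

section \<open>The restricted Lie algebra of a diagonal quadratic form\<close>

definition diag_form :: "(nat \<Rightarrow> 'k) \<Rightarrow> (nat \<Rightarrow>\<^sub>0 'k) \<Rightarrow> 'k::field" where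
  "diag_form s x = (\<Sum>i\<in>Poly_Mapping.keys x. s i * (Poly_Mapping.lookup x i)\<^sup>2)"

text \<open>Multiplication by \<open>Poly_Mapping.single 0 c\<close> in the convolution ring is multiplication by
  the scalar \<open>c\<close>, so that the ring laws give the vector space laws.\<close>

abbreviation pm_scale :: "'k \<Rightarrow> (nat \<Rightarrow>\<^sub>0 'k) \<Rightarrow> (nat \<Rightarrow>\<^sub>0 'k::field)" where
  "pm_scale c x \<equiv> Poly_Mapping.single 0 c * x"

abbreviation zero_bracket :: "(nat \<Rightarrow>\<^sub>0 'k) \<Rightarrow> (nat \<Rightarrow>\<^sub>0 'k) \<Rightarrow> (nat \<Rightarrow>\<^sub>0 'k::field)" where
  "zero_bracket x y \<equiv> 0"

definition form_pmap :: "(nat \<Rightarrow> 'k) \<Rightarrow> (nat \<Rightarrow>\<^sub>0 'k) \<Rightarrow> (nat \<Rightarrow>\<^sub>0 'k::field)" where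
  "form_pmap s x = Poly_Mapping.single 0 (diag_form s x)"

lemma lookup_pm_scale: "Poly_Mapping.lookup (pm_scale c x) i = c * Poly_Mapping.lookup x i"
  by (simp flip: mult_map_scale_conv_mult add: map.rep_eq when_def)

lemma diag_form_superset:
  assumes "finite A" "Poly_Mapping.keys x \<subseteq> A"
  shows "diag_form s x = (\<Sum>i\<in>A. s i * (Poly_Mapping.lookup x i)\<^sup>2)"
  unfolding diag_form_def using assms
  by (intro sum.mono_neutral_left) (auto simp: in_keys_iff)

text \<open>This and the next lemma are the semilinearity that the axioms of a \<open>p\<close>-map demand for
  \<open>p = 2\<close>.\<close>

lemma diag_form_scale: "diag_form s (pm_scale c x) = c\<^sup>2 * diag_form s x"
proof -
  have "diag_form s (pm_scale c x) = (\<Sum>i\<in>Poly_Mapping.keys x. s i * (Poly_Mapping.lookup (pm_scale c x) i)\<^sup>2)"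
    by (rule diag_form_superset) (auto simp: in_keys_iff lookup_pm_scale)
  also have "\<dots> = (\<Sum>i\<in>Poly_Mapping.keys x. c\<^sup>2 * (s i * (Poly_Mapping.lookup x i)\<^sup>2))"
    by (simp only: lookup_pm_scale power_mult_distrib mult.left_commute)
  finally show ?thesis
    by (simp only: diag_form_def sum_distrib_left)
qed

lemma diag_form_add:
  fixes s :: "nat \<Rightarrow> 'k::field"
  assumes "CHAR('k) = 2"
  shows "diag_form s (x + y) = diag_form s x + diag_form s y"
proof -
  let ?A = "Poly_Mapping.keys x \<union> Poly_Mapping.keys y"
  have sq: "(a + b)\<^sup>2 = a\<^sup>2 + b\<^sup>2" for a b :: 'k
    by (simp only: power2_sum mult.assoc[of 2] mult_2 double_eq_0_CHAR_2[OF assms] mult_zero_left add_0_right)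
  have "diag_form s (x + y) = (\<Sum>i\<in>?A. s i * (Poly_Mapping.lookup (x + y) i)\<^sup>2)"
    using keys_add[of x y] by (intro diag_form_superset) auto
  also have "\<dots> = (\<Sum>i\<in>?A. s i * (Poly_Mapping.lookup x i)\<^sup>2) + (\<Sum>i\<in>?A. s i * (Poly_Mapping.lookup y i)\<^sup>2)"
    by (simp add: lookup_add sq distrib_left sum.distrib)
  also have "\<dots> = diag_form s x + diag_form s y"
    using diag_form_superset[of ?A x s] diag_form_superset[of ?A y s] by simp
  finally show ?thesis .
qed

lemma diag_form_single: "diag_form s (Poly_Mapping.single i c) = s i * c\<^sup>2"
  by (subst diag_form_superset[of "{i}"]) auto

lemma lie_algebra_zero_bracket: "lie_algebra pm_scale zero_bracket"
  by unfold_locales (simp_all add: distrib_left distrib_right single_add mult_single mult.assoc[symmetric])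

lemma form_restricted_lie_algebra:
  assumes char2: "CHAR('k::field) = 2"
  shows "restricted_lie_algebra (pm_scale :: 'k \<Rightarrow> _) zero_bracket (form_pmap s)"
proof -
  interpret lie_algebra "pm_scale :: 'k \<Rightarrow> _" zero_bracket
    by (rule lie_algebra_zero_bracket)
  have "jacobson_s 1 x y = 0" for x y
    by (simp add: jacobson_s_def char2)
  moreover have "{1..<CHAR('k)} = {1}"
    using char2 by auto
  ultimately have jacobson: "(\<Sum>i = 1..<CHAR('k). jacobson_s i x y) = 0" for x y
    by simp
  show ?thesis
  proof unfold_locales
    show "form_pmap s (pm_scale c x) = pm_scale (c ^ CHAR('k)) (form_pmap s x)" for c x
      unfolding form_pmap_def diag_form_scale char2 mult_single by simp
    show "form_pmap s (x + y) = form_pmap s x + form_pmap s y + (\<Sum>i = 1..<CHAR('k). jacobson_s i x y)" for x y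
      unfolding jacobson form_pmap_def diag_form_add[OF char2] single_add by simp
  qed (simp_all add: char2 numeral_2_eq_2)
qed

text \<open>The elements of a finite set have a finite joint support, which confines the support of
  every element of its span.\<close>

lemma pm_scale_infinite_dimensional:
  "lie_algebra.infinite_dimensional (pm_scale :: 'k::field \<Rightarrow> _)"
proof -
  interpret lie_algebra "pm_scale :: 'k \<Rightarrow> _" zero_bracket
    by (rule lie_algebra_zero_bracket)
  have "span B \<noteq> UNIV" if "finite B" for B
  proof
    assume *: "span B = UNIV"
    let ?K = "\<Union>b\<in>B. Poly_Mapping.keys b"
    have "subspace {x :: nat \<Rightarrow>\<^sub>0 'k. Poly_Mapping.keys x \<subseteq> ?K}"
    proof (rule subspaceI)
      fix x y :: "nat \<Rightarrow>\<^sub>0 'k"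
      assume "x \<in> {x. Poly_Mapping.keys x \<subseteq> ?K}" "y \<in> {x. Poly_Mapping.keys x \<subseteq> ?K}"
      then show "x + y \<in> {x. Poly_Mapping.keys x \<subseteq> ?K}"
        using keys_add[of x y] by blast
    next
      fix c and x :: "nat \<Rightarrow>\<^sub>0 'k"
      have "Poly_Mapping.keys (pm_scale c x) \<subseteq> Poly_Mapping.keys x"
        by (auto simp: in_keys_iff lookup_pm_scale)
      then show "pm_scale c x \<in> {x. Poly_Mapping.keys x \<subseteq> ?K}"
        if "x \<in> {x. Poly_Mapping.keys x \<subseteq> ?K}"
        using that by blast
    qed simp
    then have "span B \<subseteq> {x. Poly_Mapping.keys x \<subseteq> ?K}"
      by (intro span_minimal) auto
    then have "Poly_Mapping.keys (Poly_Mapping.single n (1::'k)) \<subseteq> ?K" for n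
      unfolding * by blast
    then have "UNIV \<subseteq> ?K" by auto
    moreover have "finite ?K" using that by simp
    ultimately show False using finite_subset infinite_UNIV_nat by blast
  qed
  then show ?thesis unfolding infinite_dimensional_def by blast
qed

text \<open>If the form is anisotropic, then the \<open>p\<close>-map sends only \<open>0\<close> to \<open>0\<close>, and so do its
  iterates.\<close>

lemma form_p_radical:
  assumes char2: "CHAR('k::field) = 2"
    and anisotropic: "\<And>x. diag_form s x = 0 \<Longrightarrow> x = 0"
  shows "restricted_lie_algebra.p_radical (pm_scale :: 'k \<Rightarrow> _) zero_bracket (form_pmap s) = {0}"
proof -
  interpret restricted_lie_algebra "pm_scale :: 'k \<Rightarrow> _" zero_bracket "form_pmap s"
    using char2 by (rule form_restricted_lie_algebra)
  have inj: "form_pmap s x = 0 \<Longrightarrow> x = 0" for x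
    using anisotropic unfolding form_pmap_def by (metis lookup_single_eq lookup_zero)
  have "x = 0" if "(form_pmap s ^^ n) x = 0" for n x
    using that by (induction n) (auto dest: inj)
  then have "\<Union>{I. restricted_ideal I \<and> p_nil I} \<subseteq> {0}"
    unfolding p_nil_def p_nilpotent_def by blast
  then have "p_radical \<subseteq> {0}"
    unfolding p_radical_def by (intro span_minimal) (auto intro: subspaceI)
  then show ?thesis
    unfolding p_radical_def using span_zero by blast
qed

lemma form_semiperfect:
  assumes char2: "CHAR('k::field) = 2" and "s 0 = 1"
  shows "semiperfect_ring (restricted_lie_algebra.restricted_enveloping_algebra
    (pm_scale :: 'k \<Rightarrow> _) zero_bracket (form_pmap s))"
proof -
  interpret restricted_lie_algebra "pm_scale :: 'k \<Rightarrow> _" zero_bracket "form_pmap s"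
    using char2 by (rule form_restricted_lie_algebra)
  let ?e = "Poly_Mapping.single 0 1 :: nat \<Rightarrow>\<^sub>0 'k"
  show ?thesis
  proof (rule u_semiperfect_if_pmap_in_line[OF _ char2])
    show abelian_lie by (simp add: abelian_lie_def)
    show "form_pmap s ?e = ?e"
      unfolding form_pmap_def diag_form_single \<open>s 0 = 1\<close> by simp
    show "\<exists>c. form_pmap s x = pm_scale c ?e" for x
      by (auto simp: form_pmap_def mult_single)
  qed
qed

text \<open>Index \<open>0\<close> stands for the constant \<open>1\<close>, which makes the first basis vector a fixed point
  of the \<open>p\<close>-map; index \<open>i + 1\<close> stands for the indeterminate number \<open>i\<close>.\<close>

fun indet_exponent :: "nat \<Rightarrow> (nat \<Rightarrow>\<^sub>0 nat)" where
  "indet_exponent 0 = 0"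
| "indet_exponent (Suc i) = Poly_Mapping.single i 1"

lemma indet_exponent_parity:
  assumes "indet_exponent i + (m + m) = indet_exponent j + (n + n)"
  shows "i = j"
proof -
  have par: "odd (Poly_Mapping.lookup (indet_exponent i) l) \<longleftrightarrow> odd (Poly_Mapping.lookup (indet_exponent j) l)" for l
    using arg_cong[OF assms, of "\<lambda>x. odd (Poly_Mapping.lookup x l)"] by (simp add: lookup_add)
  have "odd (Poly_Mapping.lookup (indet_exponent k) l) \<longleftrightarrow> k = Suc l" for k l
    by (cases k) (auto simp: lookup_single when_def)
  with par have "i = Suc l \<longleftrightarrow> j = Suc l" for l by simp
  then show ?thesis by (metis not0_implies_Suc)
qed

definition indet :: "nat \<Rightarrow> 'f::field rat_funs" where
  "indet i = to_fract (Poly_Mapping.single (indet_exponent i) 1)"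

lemma indet_form_anisotropic:
  assumes "CHAR('f::field) = 2" and "diag_form (indet :: nat \<Rightarrow> 'f rat_funs) x = 0"
  shows "x = 0"
proof -
  have "Poly_Mapping.lookup x i = 0" if "i \<in> Poly_Mapping.keys x" for i
  proof (rule fract_square_independent[OF _ finite_keys[of x] _ that])
    show "(\<Sum>i\<in>Poly_Mapping.keys x. to_fract (Poly_Mapping.single (indet_exponent i) 1) * (Poly_Mapping.lookup x i)\<^sup>2) = 0"
      using assms(2) by (simp only: diag_form_def indet_def)
    show "b j = 0"
      if "(\<Sum>i\<in>Poly_Mapping.keys x. Poly_Mapping.single (indet_exponent i) 1 * (b i * b i)) = 0"
        and "j \<in> Poly_Mapping.keys x"
      for b :: "nat \<Rightarrow> ((nat \<Rightarrow>\<^sub>0 nat) \<Rightarrow>\<^sub>0 'f)" and j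
      using monomials_square_independent[OF assms(1) indet_exponent_parity finite_keys that] .
  qed
  then show ?thesis by (metis in_keys_iff poly_mapping_eqI lookup_zero)
qed

theorem theorem2p11:
  assumes "CHAR('f::field) = 2"
  shows "\<exists>(scale :: 'f rat_funs \<Rightarrow> (nat \<Rightarrow>\<^sub>0 'f rat_funs) \<Rightarrow> (nat \<Rightarrow>\<^sub>0 'f rat_funs)) bracket pmap.
     restricted_lie_algebra scale bracket pmap \<and>
     lie_algebra.abelian_lie bracket \<and>
     lie_algebra.infinite_dimensional scale \<and>
     semiperfect_ring (restricted_lie_algebra.restricted_enveloping_algebra scale bracket pmap) \<and>
     restricted_lie_algebra.p_radical scale bracket pmap = {0}"
proof -
  let ?s = "indet :: nat \<Rightarrow> 'f rat_funs"
  have char2: "CHAR('f rat_funs) = 2"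
    using assms by (simp only: CHAR_rat_funs)
  have "?s 0 = 1"
    by (simp add: indet_def)
  then have "restricted_lie_algebra pm_scale zero_bracket (form_pmap ?s) \<and>
     lie_algebra.abelian_lie (zero_bracket :: _ \<Rightarrow> _ \<Rightarrow> (nat \<Rightarrow>\<^sub>0 'f rat_funs)) \<and>
     lie_algebra.infinite_dimensional (pm_scale :: 'f rat_funs \<Rightarrow> _) \<and>
     semiperfect_ring (restricted_lie_algebra.restricted_enveloping_algebra pm_scale zero_bracket (form_pmap ?s)) \<and>
     restricted_lie_algebra.p_radical pm_scale zero_bracket (form_pmap ?s) = {0}"
    using form_restricted_lie_algebra[OF char2] form_semiperfect[OF char2]
      form_p_radical[OF char2 indet_form_anisotropic[OF assms]]
      pm_scale_infinite_dimensional lie_algebra.abelian_lie_def[OF lie_algebra_zero_bracket]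
    by blast
  then show ?thesis by blast
qed

end
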